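(* For every integer $r\ge -1$, \[ \sum_{n=1}^\infty \frac{1}{n^2(2n+2r+1)}\frac{2^{2n}}{\binom{2n}{n}}\frac{2^{2n}}{\binom{2n+2r}{n+r}}=\frac{1}{2^{2r-1}}\int_0^{\pi/2}x^2\sin^{2r+1}x\,dx. \] *)

theory Defs
  imports "HOL-Analysis.Analysis"
begin

end

theory Submission
  imports Defs "HOL-Real_Asymp.Real_Asymp"
begin

text \<open>
  The partial sums \<open>S\<^sub>N\<close> of the expansion of \<open>x\<^sup>2\<close> in even powers of \<open>sin x\<close> satisfy
  \<open>S\<^sub>N'' = 2 - b\<^sub>N sin\<^bsup>2N\<^esup> x\<close> with \<open>b\<^sub>N = 2 * 4\<^sup>N / binom(2N,N)\<close>, because the coefficients are chosen
  so that the second derivatives telescope. Taylor's formula for \<open>x\<^sup>2 - S\<^sub>N\<close> then gives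
  \<open>0 \<le> x\<^sup>2 - S\<^sub>N x \<le> b\<^sub>N x\<^sup>2 sin\<^bsup>2N\<^esup> x / 2\<close>, which vanishes in the limit for \<open>x < \<pi>/2\<close> since
  \<open>b\<^sub>N\<close> grows at most linearly. Dominated convergence and Wallis' integral for
  odd powers of the sine finish the proof.
\<close>

section \<open>Coefficients of the squared arcsine series, indexed from 0, and their
  recurrences\<close>

definition sin_sq_coeff :: "nat \<Rightarrow> real" where
  "sin_sq_coeff k = 4 ^ Suc k / (2 * real (Suc k) ^ 2 * real ((2 * Suc k) choose Suc k))"

lemma sin_sq_coeff_nonneg: "sin_sq_coeff k \<ge> 0"
  by (simp add: sin_sq_coeff_def)

text \<open>Absorption takes \<open>(2n+2) choose (n+1)\<close> down to
  \<open>(2n+1) choose n\<close>. Symmetry turns this into \<open>(2n+1) choose (n+1)\<close>, to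
  which absorption applies once more.\<close>

lemma central_binomial_Suc:
  "(real n + 1) * real ((2 * Suc n) choose Suc n) = 2 * (2 * real n + 1) * real ((2 * n) choose n)"
proof -
  have 1: "Suc n * (Suc (Suc (2 * n)) choose Suc n) = Suc (Suc (2 * n)) * (Suc (2 * n) choose n)"
    by (rule Suc_times_binomial)
  have 2: "Suc n * (Suc (2 * n) choose Suc n) = Suc (2 * n) * ((2 * n) choose n)"
    by (rule Suc_times_binomial)
  have 3: "Suc (2 * n) choose Suc n = Suc (2 * n) choose n"
    by (subst binomial_symmetric) auto
  \<comment> \<open>The extra factor \<open>Suc n\<close> is what the second absorption consumes; it
    is cancelled afterwards.\<close>
  have "Suc n * (Suc n * (Suc (Suc (2 * n)) choose Suc n))
          = Suc n * (2 * (Suc (2 * n) * ((2 * n) choose n)))"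
  proof -
    have "Suc n * (Suc n * (Suc (Suc (2 * n)) choose Suc n)) = Suc n * (2 * (Suc n * (Suc (2 * n) choose n)))"
      unfolding 1 by simp
    then show ?thesis using 2 unfolding 3 by (simp only:)
  qed
  then have "Suc n * (Suc (Suc (2 * n)) choose Suc n) = 2 * (Suc (2 * n) * ((2 * n) choose n))"
    by (simp only: mult_cancel1) simp
  then have "real (Suc n * (Suc (Suc (2 * n)) choose Suc n))
          = real (2 * (Suc (2 * n) * ((2 * n) choose n)))"
    by (simp only:)
  then show ?thesis
    by (simp del: binomial_Suc_Suc add: algebra_simps)
qed

text \<open>The factor (2n+2)(2n+1) is the coefficient of sin^(2n) in the second derivative of
  sin^(2n+2), that is, in (2n+2)(2n+1) sin^(2n) - (2n+2)^2 sin^(2n+2).\<close>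

lemma sin_sq_coeff_step:
  "sin_sq_coeff n * ((2 * real n + 2) * (2 * real n + 1)) = 2 * 4 ^ n / real ((2 * n) choose n)"
proof -
  define B where "B = real ((2 * n) choose n)"
  define C where "C = real ((2 * Suc n) choose Suc n)"
  have B: "B > 0" and C: "C > 0" by (simp_all add: B_def C_def del: binomial_Suc_Suc mult_Suc_right)
  have BC: "(real n + 1) * C = 2 * (2 * real n + 1) * B"
    unfolding B_def C_def by (rule central_binomial_Suc)
  have "sin_sq_coeff n = 4 ^ Suc n / (2 * (real n + 1) ^ 2 * C)"
    by (simp add: sin_sq_coeff_def C_def add.commute del: binomial_Suc_Suc mult_Suc_right)
  then have "sin_sq_coeff n * ((2 * real n + 2) * (2 * real n + 1))
        = 4 ^ Suc n * (2 * (real n + 1) * (2 * real n + 1)) / (2 * (real n + 1) ^ 2 * C)"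
    by simp
  also have "\<dots> = 4 ^ Suc n * (2 * real n + 1) / ((real n + 1) * C)"
    using C by (simp add: divide_simps power2_eq_square)
  also have "\<dots> = 2 * 4 ^ n / B"
    unfolding BC using B by (simp add: divide_simps)
  finally show ?thesis by (simp add: B_def)
qed

text \<open>Treats the sin^(2n+2) part of the same second derivative. The value is that of
  \<open>sin_sq_coeff_step\<close> at n+1, which is what makes the sum telescope.\<close>

lemma sin_sq_coeff_mult_square:
  "sin_sq_coeff n * (2 * real n + 2) ^ 2 = 2 * 4 ^ Suc n / real ((2 * Suc n) choose Suc n)"
proof -
  have "(2 * real n + 2) ^ 2 = 4 * real (Suc n) ^ 2"
    by (simp add: power2_eq_square algebra_simps)
  then show ?thesis
    by (simp add: sin_sq_coeff_def divide_simps del: binomial_Suc_Suc mult_Suc_right of_nat_Suc)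
qed

section \<open>Partial sums of the expansion of x^2 in powers of sin x, and their remainder\<close>

definition sin_sq_sum :: "nat \<Rightarrow> real \<Rightarrow> real" where
  "sin_sq_sum N x = (\<Sum>k<N. sin_sq_coeff k * sin x ^ (2 * k + 2))"

definition sin_sq_sum' :: "nat \<Rightarrow> real \<Rightarrow> real" where
  "sin_sq_sum' N x = (\<Sum>k<N. sin_sq_coeff k * ((2 * real k + 2) * sin x ^ (2 * k + 1) * cos x))"

lemma DERIV_sin_power_Suc:
  fixes x :: real
  shows "((\<lambda>x. sin x ^ Suc n) has_real_derivative (real n + 1) * sin x ^ n * cos x) (at x within A)"
  using DERIV_power[OF has_field_derivative_at_within[OF DERIV_sin], where n = "Suc n"]
  by (simp add: mult_ac add.commute)

lemma DERIV_sin_sq_sum: "DERIV (sin_sq_sum N) x :> sin_sq_sum' N x"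
proof -
  have "DERIV (\<lambda>x. sin x ^ (2 * k + 2)) x :> (2 * real k + 2) * sin x ^ (2 * k + 1) * cos x" for k
    using DERIV_sin_power_Suc[of "2 * k + 1" x UNIV] by (simp add: add.commute)
  then show ?thesis
    unfolding sin_sq_sum_def sin_sq_sum'_def by (intro DERIV_sum DERIV_cmult)
qed

text \<open>With b_N = 2 * 4^N / binom(2N,N), the N-th term contributes b_N sin^(2N) - b_(N+1)
  sin^(2N+2). The sum therefore telescopes, starting from b_0 = 2.\<close>

lemma DERIV_sin_sq_sum':
  "DERIV (sin_sq_sum' N) x :> 2 - 2 * 4 ^ N / real ((2 * N) choose N) * sin x ^ (2 * N)"
proof (induction N)
  case 0
  then show ?case by (simp add: sin_sq_sum'_def)
next
  case (Suc N)
  have cos2: "cos x * cos x = 1 - sin x ^ 2"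
    by (simp add: cos_squared_eq flip: power2_eq_square)
  have "((\<lambda>x. (2 * real N + 2) * sin x ^ (2 * N + 1) * cos x) has_real_derivative
           (2 * real N + 2) * (2 * real N + 1) * sin x ^ (2 * N) * (cos x * cos x)
             - (2 * real N + 2) * (sin x ^ (2 * N) * sin x ^ 2)) (at x)"
  proof -
    have "((\<lambda>x. sin x ^ (2 * N + 1)) has_real_derivative (2 * real N + 1) * sin x ^ (2 * N) * cos x) (at x)"
      using DERIV_sin_power_Suc[of "2 * N" x UNIV] by simp
    then have "((\<lambda>x. (2 * real N + 2) * (sin x ^ (2 * N + 1) * cos x)) has_real_derivative
        (2 * real N + 2) * ((2 * real N + 1) * sin x ^ (2 * N) * cos x * cos x
           + - sin x * sin x ^ (2 * N + 1))) (at x)"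
      by (intro DERIV_cmult DERIV_mult DERIV_cos)
    then show ?thesis
      by (simp add: algebra_simps power2_eq_square)
  qed
  \<comment> \<open>Eliminating cos^2 leaves only even powers of the sine.\<close>
  also have "(2 * real N + 2) * (2 * real N + 1) * sin x ^ (2 * N) * (cos x * cos x)
             - (2 * real N + 2) * (sin x ^ (2 * N) * sin x ^ 2)
      = (2 * real N + 2) * (2 * real N + 1) * sin x ^ (2 * N)
          - (2 * real N + 2) ^ 2 * sin x ^ (2 * Suc N)"
    unfolding cos2 by (simp add: algebra_simps power2_eq_square)
  finally have "((\<lambda>x. sin_sq_sum' N x
        + sin_sq_coeff N * ((2 * real N + 2) * sin x ^ (2 * N + 1) * cos x)) has_real_derivative
      (2 - 2 * 4 ^ N / real ((2 * N) choose N) * sin x ^ (2 * N))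
       + sin_sq_coeff N * ((2 * real N + 2) * (2 * real N + 1) * sin x ^ (2 * N)
          - (2 * real N + 2) ^ 2 * sin x ^ (2 * Suc N))) (at x)"
    by (intro DERIV_add Suc.IH DERIV_cmult)
  also have "(\<lambda>x. sin_sq_sum' N x
        + sin_sq_coeff N * ((2 * real N + 2) * sin x ^ (2 * N + 1) * cos x)) = sin_sq_sum' (Suc N)"
    by (auto simp: sin_sq_sum'_def)
  also have "sin_sq_coeff N * ((2 * real N + 2) * (2 * real N + 1) * sin x ^ (2 * N)
          - (2 * real N + 2) ^ 2 * sin x ^ (2 * Suc N))
      = (sin_sq_coeff N * ((2 * real N + 2) * (2 * real N + 1))) * sin x ^ (2 * N)
         - (sin_sq_coeff N * (2 * real N + 2) ^ 2) * sin x ^ (2 * Suc N)"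
    by (simp only: right_diff_distrib mult.assoc)
  finally show ?case
    by (simp only: sin_sq_coeff_step sin_sq_coeff_mult_square) (simp only: add_diff_eq diff_add_cancel)
qed

text \<open>Maclaurin's formula of order 2 with Lagrange remainder: the difference and its first
  derivative vanish at 0, and the 2 in b_N cancels against \<open>fact 2\<close>.\<close>

lemma sin_sq_sum_remainder:
  assumes "x > 0"
  obtains t where "0 < t" "t < x"
    "x ^ 2 - sin_sq_sum N x = 4 ^ N / real ((2 * N) choose N) * sin t ^ (2 * N) * x ^ 2"
proof -
  define b where "b = 2 * 4 ^ N / real ((2 * N) choose N)"
  define d :: "nat \<Rightarrow> real \<Rightarrow> real" where
    "d m = (if m = 0 then (\<lambda>x. x ^ 2 - sin_sq_sum N x)
            else if m = 1 then (\<lambda>x. 2 * x - sin_sq_sum' N x) else (\<lambda>x. b * sin x ^ (2 * N)))" for m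
  have "DERIV (d m) t :> d (Suc m) t" if "m < 2" for m t
  proof -
    have "DERIV (d 0) t :> d 1 t"
      unfolding d_def by (auto intro!: derivative_eq_intros DERIV_sin_sq_sum)
    moreover have "DERIV (d 1) t :> d 2 t"
      unfolding d_def b_def by (auto intro!: derivative_eq_intros DERIV_sin_sq_sum')
    ultimately show ?thesis using that by (auto simp: less_2_cases_iff simp flip: One_nat_def numeral_2_eq_2)
  qed
  then obtain t where "0 < t" "t < x"
    "d 0 x = (\<Sum>m<2. d m 0 / fact m * x ^ m) + d 2 t / fact 2 * x ^ 2"
    using Maclaurin[OF assms, of 2 d "d 0"] by auto
  moreover have "d 0 0 = 0" "d 1 0 = 0"
    by (simp_all add: d_def sin_sq_sum_def sin_sq_sum'_def)
  ultimately show thesis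
    by (intro that[of t]) (auto simp: numeral_2_eq_2 d_def b_def)
qed

lemma sin_sq_sum_nonneg: "sin_sq_sum N x \<ge> 0"
  unfolding sin_sq_sum_def
  by (intro sum_nonneg mult_nonneg_nonneg sin_sq_coeff_nonneg zero_le_even_power) simp

text \<open>The Lagrange remainder contains only an even power of a sine. Together with
  \<open>sin_sq_sum_nonneg\<close> this gives the bound for dominated convergence.\<close>

lemma sin_sq_sum_le:
  assumes "x > 0"
  shows "sin_sq_sum N x \<le> x ^ 2"
proof -
  obtain t where "x ^ 2 - sin_sq_sum N x = 4 ^ N / real ((2 * N) choose N) * sin t ^ (2 * N) * x ^ 2"
    using sin_sq_sum_remainder[OF assms] by metis
  moreover have "\<dots> \<ge> 0" by simp
  ultimately show ?thesis by linarith
qed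

lemma sin_sq_sum_tendsto:
  assumes "0 < x" "x < pi / 2"
  shows "(\<lambda>N. sin_sq_sum N x) \<longlonglongrightarrow> x ^ 2"
proof -
  define q where "q = sin x ^ 2"
  have sx: "0 < sin x" "sin x < 1"
    using assms sin_gt_zero[of x] sin_monotone_2pi[of x "pi/2"] by auto
  then have q: "0 < q" "q < 1" by (auto simp: q_def power_less_one_iff)
  have bound: "norm (sin_sq_sum N x - x ^ 2) \<le> (2 * real N * q ^ N) * x ^ 2" if N: "N > 0" for N
  proof -
    obtain t where t: "0 < t" "t < x"
      "x ^ 2 - sin_sq_sum N x = 4 ^ N / real ((2 * N) choose N) * sin t ^ (2 * N) * x ^ 2"
      using sin_sq_sum_remainder[OF assms(1)] by metis
    \<comment> \<open>The sine is increasing up to pi/2, so the unknown t, which depends on N, can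
      be replaced by the fixed x.\<close>
    have "0 \<le> sin t" "sin t \<le> sin x"
      using t assms by (auto intro!: sin_ge_zero sin_monotone_2pi_le)
    then have "sin t ^ (2 * N) \<le> q ^ N"
      unfolding q_def power_mult[symmetric] by (intro power_mono)
    \<comment> \<open>Linear growth in N is harmless, since q < 1 makes N q^N tend to 0.\<close>
    moreover have "4 ^ N / real ((2 * N) choose N) \<le> 2 * real N"
      using central_binomial_lower_bound[OF N] N by (simp add: field_simps)
    ultimately have "4 ^ N / real ((2 * N) choose N) * sin t ^ (2 * N) * x ^ 2
                       \<le> (2 * real N * q ^ N) * x ^ 2"
      by (intro mult_right_mono mult_mono) auto
    then show ?thesis
      using t(3) sin_sq_sum_le[OF assms(1), of N] by (simp add: abs_if)
  qed
  have "(\<lambda>N. real N * q ^ N) \<longlonglongrightarrow> 0"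
    using q by (intro powser_times_n_limit_0) auto
  then have lim: "(\<lambda>N. (2 * real N * q ^ N) * x ^ 2) \<longlonglongrightarrow> 0"
    using tendsto_mult[OF tendsto_mult[OF tendsto_const[of 2]] tendsto_const[of "x ^ 2"]]
    by (fastforce simp: mult.assoc)
  have "(\<lambda>N. sin_sq_sum N x - x ^ 2) \<longlonglongrightarrow> 0"
    by (rule Lim_null_comparison[OF _ lim]) (use bound in \<open>auto intro!: eventually_sequentiallyI[of 1]\<close>)
  then show ?thesis by (simp add: LIM_zero_iff)
qed

section \<open>Wallis' integral for odd powers of the sine\<close>

lemma has_integral_sin_odd_power:
  "((\<lambda>x. sin x ^ (2 * m + 1)) has_integral (4 ^ m / ((2 * real m + 1) * real ((2 * m) choose m))))
     {0..pi / 2}"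
proof (induction m)
  case 0
  have "(sin has_integral (- cos (pi / 2) - (- cos 0))) {0..pi / 2}"
    by (rule fundamental_theorem_of_calculus)
       (auto intro!: derivative_eq_intros simp flip: has_real_derivative_iff_has_vector_derivative)
  then show ?case by simp
next
  case (Suc m)
  \<comment> \<open>Encodes the integration by parts: F' = (2m+3) sin^(2m+3) - (2m+2) sin^(2m+1),
    and F vanishes at both endpoints.\<close>
  define F :: "real \<Rightarrow> real" where "F = (\<lambda>x. - (cos x * sin x ^ (2 * m + 2)))"
  have cos2: "cos x * cos x = 1 - sin x ^ 2" for x :: real
    by (simp add: cos_squared_eq flip: power2_eq_square)
  have "(F has_real_derivative
      (2 * real m + 3) * sin x ^ (2 * Suc m + 1) - (2 * real m + 2) * sin x ^ (2 * m + 1)) (at x within A)"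
    for x A
  proof -
    have "(F has_real_derivative
      sin x * sin x ^ (2 * m + 2) - (2 * real m + 2) * sin x ^ (2 * m + 1) * (cos x * cos x)) (at x within A)"
    proof -
      have "((\<lambda>x. sin x ^ (2 * m + 2)) has_real_derivative (2 * real m + 2) * sin x ^ (2 * m + 1) * cos x)
              (at x within A)"
        using DERIV_sin_power_Suc[of "2 * m + 1" x A] by (simp add: add.commute)
      then have "(F has_real_derivative - (- sin x * sin x ^ (2 * m + 2)
                    + (2 * real m + 2) * sin x ^ (2 * m + 1) * cos x * cos x)) (at x within A)"
        unfolding F_def by (intro DERIV_minus DERIV_mult has_field_derivative_at_within[OF DERIV_cos])
      then show ?thesis by (simp add: mult.assoc)
    qed
    then show ?thesis unfolding cos2 by (simp add: algebra_simps power2_eq_square)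
  qed
  then have "((\<lambda>x. (2 * real m + 3) * sin x ^ (2 * Suc m + 1) - (2 * real m + 2) * sin x ^ (2 * m + 1))
      has_integral (F (pi / 2) - F 0)) {0..pi / 2}"
    by (intro fundamental_theorem_of_calculus)
       (auto simp flip: has_real_derivative_iff_has_vector_derivative)
  \<comment> \<open>Adding (2m+2) times the induction hypothesis isolates the higher power.\<close>
  from has_integral_add[OF this has_integral_mult_right[OF Suc.IH, of "2 * real m + 2"]]
  have "((\<lambda>x. (2 * real m + 3) * sin x ^ (2 * Suc m + 1)) has_integral
      ((2 * real m + 2) * (4 ^ m / ((2 * real m + 1) * real ((2 * m) choose m))))) {0..pi / 2}"
    by (simp add: F_def)
  from has_integral_mult_right[OF this, of "1 / (2 * real m + 3)"]
  have "((\<lambda>x. sin x ^ (2 * Suc m + 1)) has_integral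
      ((2 * real m + 2) * (4 ^ m / ((2 * real m + 1) * real ((2 * m) choose m))) / (2 * real m + 3)))
      {0..pi / 2}"
    by (simp add: add_eq_0_iff mult_ac)
  \<comment> \<open>The reduction factor (2m+2)/(2m+3) matches the quotient of consecutive closed
    forms by the central binomial recurrence.\<close>
  moreover have "(2 * real m + 2) * (4 ^ m / ((2 * real m + 1) * real ((2 * m) choose m))) / (2 * real m + 3)
    = 4 ^ Suc m / ((2 * real (Suc m) + 1) * real ((2 * Suc m) choose Suc m))"
  proof -
    define B where "B = real ((2 * m) choose m)"
    define C where "C = real ((2 * Suc m) choose Suc m)"
    have B: "B > 0" and C: "C > 0"
      by (simp_all add: B_def C_def del: binomial_Suc_Suc mult_Suc_right)
    have BC: "2 * (2 * real m + 1) * B = (real m + 1) * C"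
      unfolding B_def C_def by (rule central_binomial_Suc[symmetric])
    have "(2 * real m + 2) * (4 ^ m / ((2 * real m + 1) * B)) / (2 * real m + 3)
        = 4 ^ Suc m * (real m + 1) / ((2 * real m + 3) * (2 * (2 * real m + 1) * B))"
      using B by (simp add: divide_simps) (simp add: algebra_simps)
    also have "\<dots> = 4 ^ Suc m / ((2 * real (Suc m) + 1) * C)"
      unfolding BC using C by (simp add: divide_simps)
    finally show ?thesis
      unfolding B_def C_def .
  qed
  ultimately show ?case by (simp only:)
qed

section \<open>Integrability of x^2 times an integer power of the sine\<close>

lemma continuous_on_square_div_sin:
  "continuous_on {0..pi / 2} (\<lambda>x::real. x ^ 2 * inverse (sin x))"
proof (rule continuous_at_imp_continuous_on, rule ballI)
  fix x :: real assume x: "x \<in> {0..pi / 2}"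
  show "isCont (\<lambda>x. x ^ 2 * inverse (sin x)) x"
  proof (cases "x = 0")
    case True
    \<comment> \<open>The limit 0 agrees with the value at 0, where the factor x^2 vanishes.\<close>
    have "((\<lambda>x::real. x ^ 2 * inverse (sin x)) \<longlongrightarrow> 0) (at 0)"
      by real_asymp
    with True show ?thesis by (simp add: isCont_def)
  next
    case False
    then have "sin x > 0" using x by (intro sin_gt_zero) auto
    then show ?thesis by (intro continuous_intros) auto
  qed
qed

text \<open>Splitting off x^2 / sin x, which is continuous on the closed interval, leaves the
  exponent j+1, which is nonnegative. This covers j = -1, the exponent arising from r = -1.\<close>

lemma integrable_square_sin_powi:
  assumes "j \<ge> -1"
  shows "(\<lambda>x::real. x ^ 2 * sin x powi j) integrable_on {0..pi / 2}"
proof -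
  have "(\<lambda>x::real. x ^ 2 * inverse (sin x) * sin x ^ nat (j + 1)) integrable_on {0..pi / 2}"
    by (intro integrable_continuous_real continuous_intros continuous_on_square_div_sin)
  \<comment> \<open>On the open interval the sine is nonzero, so exponents may be added; the
    endpoints do not affect integrability.\<close>
  then have "(\<lambda>x::real. x ^ 2 * inverse (sin x) * sin x ^ nat (j + 1)) integrable_on {0<..<pi / 2}"
    by (simp add: integrable_on_Icc_iff_Ioo)
  moreover have "x ^ 2 * inverse (sin x) * sin x ^ nat (j + 1) = x ^ 2 * sin x powi j"
    if "x \<in> {0<..<pi / 2}" for x
  proof -
    have "sin x > 0" using that by (intro sin_gt_zero) auto
    then have "sin x powi (j + 1) = sin x powi j * sin x"
      by (simp add: power_int_add)
    moreover have "sin x ^ nat (j + 1) = sin x powi (j + 1)"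
      using assms by (simp add: power_int_def)
    ultimately show ?thesis using \<open>sin x > 0\<close> by simp
  qed
  ultimately have "(\<lambda>x::real. x ^ 2 * sin x powi j) integrable_on {0<..<pi / 2}"
    by (subst (asm) integrable_cong) auto
  then show ?thesis by (simp add: integrable_on_Icc_iff_Ioo)
qed

section \<open>Termwise integration and comparison of the terms\<close>

theorem theorem12:
  fixes r :: int
  assumes "r \<ge> - 1"
  shows "(\<lambda>x::real. x ^ 2 * sin x powi (2 * r + 1)) integrable_on {0..pi / 2} \<and>
    (\<lambda>k::nat. let n = Suc k in
       1 / (real n ^ 2 * real_of_int (2 * int n + 2 * r + 1))
       * (2 ^ (2 * n) / real ((2 * n) choose n))
       * (2 ^ (2 * n) / real (nat (2 * int n + 2 * r) choose nat (int n + r))))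
    sums (1 / 2 powi (2 * r - 1)
       * integral {0..pi / 2} (\<lambda>x::real. x ^ 2 * sin x powi (2 * r + 1)))"
proof -
  \<comment> \<open>Working on the open interval gives a positive sine for the \<open>powi\<close>
    laws and x < pi/2 for pointwise convergence.\<close>
  define I where "I = {0<..<pi / 2}"
  define w where "w = (\<lambda>x::real. sin x powi (2 * r + 1))"
  \<comment> \<open>With n = k+1 this is n + r, nonnegative because r >= -1, so \<open>nat\<close>
    loses nothing. \<open>W k\<close> is the Wallis integral of sin^(2 m k + 1).\<close>
  define m where "m k = nat (int (Suc k) + r)" for k
  define W where "W k = 4 ^ m k / ((2 * real (m k) + 1) * real ((2 * m k) choose m k))" for k
  have int_m: "int (m k) = int k + 1 + r" for k
    using assms by (simp add: m_def)
  have real_m: "real (m k) = real k + 1 + real_of_int r" for k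
    using arg_cong[OF int_m[of k], of real_of_int] by simp
  have sin_pos: "sin x > 0" if "x \<in> I" for x
    using that unfolding I_def by (intro sin_gt_zero) auto
  have int_w: "(\<lambda>x. x ^ 2 * w x) integrable_on {0..pi / 2}"
    unfolding w_def using assms by (intro integrable_square_sin_powi) auto
  have terms: "((\<lambda>x. sin x ^ (2 * k + 2) * w x) has_integral W k) I" for k
  proof -
    have "((\<lambda>x. sin x ^ (2 * m k + 1)) has_integral W k) I"
      using has_integral_sin_odd_power[of "m k"]
      unfolding W_def I_def by (simp only: has_integral_Icc_iff_Ioo)
    moreover have "sin x ^ (2 * k + 2) * w x = sin x ^ (2 * m k + 1)" if "x \<in> I" for x
    proof -
      have "sin x ^ (2 * k + 2) * w x = sin x powi (int (2 * k + 2) + (2 * r + 1))"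
        unfolding w_def power_int_of_nat[symmetric]
        using sin_pos[OF that] by (subst power_int_add) auto
      also have "int (2 * k + 2) + (2 * r + 1) = int (2 * m k + 1)"
        by (simp add: int_m)
      finally show ?thesis by (simp only: power_int_of_nat)
    qed
    ultimately show ?thesis by (simp only: cong: has_integral_cong)
  qed
  have partial: "((\<lambda>x. sin_sq_sum N x * w x) has_integral (\<Sum>k<N. sin_sq_coeff k * W k)) I" for N
  proof -
    have "((\<lambda>x. \<Sum>k<N. sin_sq_coeff k * (sin x ^ (2 * k + 2) * w x)) has_integral
            (\<Sum>k<N. sin_sq_coeff k * W k)) I"
      by (intro has_integral_sum has_integral_mult_right terms) auto
    then show ?thesis by (simp add: sin_sq_sum_def sum_distrib_right mult.assoc)
  qed
  have "(\<lambda>N. integral I (\<lambda>x. sin_sq_sum N x * w x)) \<longlonglongrightarrow> integral I (\<lambda>x. x ^ 2 * w x)"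
  \<comment> \<open>The limit function x^2 \<open>w x\<close> itself dominates, because the partial
    sums lie between 0 and x^2.\<close>
  proof (rule dominated_convergence(2))
    show "(\<lambda>x. sin_sq_sum N x * w x) integrable_on I" for N
      using partial by blast
    show "(\<lambda>x. x ^ 2 * w x) integrable_on I"
      using int_w by (simp add: I_def integrable_on_Icc_iff_Ioo)
    show "norm (sin_sq_sum N x * w x) \<le> x ^ 2 * w x" if "x \<in> I" for N x
    proof -
      have "w x > 0" using sin_pos[OF that] by (simp add: w_def)
      moreover have "sin_sq_sum N x \<le> x ^ 2"
        using that by (intro sin_sq_sum_le) (auto simp: I_def)
      ultimately show ?thesis
        using sin_sq_sum_nonneg[of N x] by (simp add: abs_mult mult_right_mono)
    qed
    show "(\<lambda>N. sin_sq_sum N x * w x) \<longlonglongrightarrow> x ^ 2 * w x" if "x \<in> I" for x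
      using that by (intro tendsto_mult tendsto_const sin_sq_sum_tendsto) (auto simp: I_def)
  qed
  moreover have "integral I (\<lambda>x. sin_sq_sum N x * w x) = (\<Sum>k<N. sin_sq_coeff k * W k)" for N
    using partial by (rule integral_unique)
  moreover have "integral I (\<lambda>x. x ^ 2 * w x) = integral {0..pi / 2} (\<lambda>x. x ^ 2 * w x)"
    unfolding I_def by (rule integral_open_interval_real[symmetric])
  ultimately have "(\<lambda>k. sin_sq_coeff k * W k) sums integral {0..pi / 2} (\<lambda>x. x ^ 2 * w x)"
    by (simp add: sums_def)
  then have "(\<lambda>k. 1 / 2 powi (2 * r - 1) * (sin_sq_coeff k * W k)) sums
      (1 / 2 powi (2 * r - 1) * integral {0..pi / 2} (\<lambda>x. x ^ 2 * w x))"
    by (rule sums_mult)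
  moreover have "1 / 2 powi (2 * r - 1) * (sin_sq_coeff k * W k) = (let n = Suc k in
       1 / (real n ^ 2 * real_of_int (2 * int n + 2 * r + 1))
       * (2 ^ (2 * n) / real ((2 * n) choose n))
       * (2 ^ (2 * n) / real (nat (2 * int n + 2 * r) choose nat (int n + r))))" for k
  proof -
    define n where "n = Suc k"
    define p where "p = (2 :: real) powi (2 * r - 1)"
    define B where "B = real ((2 * n) choose n)"
    define C where "C = real ((2 * m k) choose m k)"
    have C': "real (nat (2 * int n + 2 * r) choose nat (int n + r)) = C"
    proof -
      have "nat (2 * int n + 2 * r) = 2 * m k" "nat (int n + r) = m k"
        using int_m[of k] by (auto simp: n_def m_def)
      then show ?thesis by (simp add: C_def)
    qed
    have D: "real_of_int (2 * int n + 2 * r + 1) = 2 * real (m k) + 1"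
      by (simp add: real_m n_def)
    have pos: "p > 0" "n > 0" "B > 0" "C > 0"
      by (auto simp: p_def n_def B_def C_def simp del: binomial_Suc_Suc mult_Suc_right)
    \<comment> \<open>Since m k = n + r, 4^(m k) equals 2^(2n) * 2^(2r) with 2^(2r) = 2p. Here p
      cancels the prefactor, and the 2 cancels the one in the denominator of
      \<open>sin_sq_coeff\<close>.\<close>
    have "(4 :: real) ^ m k = 2 ^ (2 * m k)"
      by (simp add: power_mult)
    also have "\<dots> = 2 powi int (2 * m k)"
      by (rule power_int_of_nat[symmetric])
    also have "int (2 * m k) = int (2 * n) + ((2 * r - 1) + 1)"
      by (simp add: int_m n_def)
    also have "(2 :: real) powi \<dots> = 2 ^ (2 * n) * (p * 2)"
    proof -
      have "(2 :: real) powi (2 * r - 1 + 1) = p * 2"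
        unfolding p_def by (subst power_int_add) simp_all
      then show ?thesis
        by (subst power_int_add) (simp_all only: power_int_of_nat, simp)
    qed
    finally have four_m: "(4 :: real) ^ m k = 2 ^ (2 * n) * (p * 2)" .
    have four_n: "(4 :: real) ^ n = 2 ^ (2 * n)"
      by (simp add: power_mult)
    show ?thesis
      unfolding Let_def n_def[symmetric] C' D sin_sq_coeff_def W_def four_m four_n
        p_def[symmetric] B_def[symmetric] C_def[symmetric]
      using pos by (simp add: divide_simps)
  qed
  ultimately show ?thesis
    using int_w by (simp only: w_def)
qed

end
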